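(* Let $G$ be an ordinary wheel consisting of the cycle $v_1v_2\dots v_kv_1$ ($k\ge3$) and an inner vertex $v$ adjacent to all $v_i$, with principal path $\overrightarrow{v_kv_1v_2}$. Then $P(G-\overrightarrow{v_kv_1v_2})$ contains a non-vanishing monomial $\eta\, v_1^0v_2^0v_k^0v^{\alpha}\prod_{i=3}^{k-1}v_i^{\alpha_i}$ with $\alpha_i\le2$ and $\alpha\le4$ if and only if $k$ is even.
   Context: For a graph $G$, vertices are also variables and $P(G)=\prod_{uv\in E(G),\,u<v}(u-v)$ for a fixed arbitrary orientation (only the overall sign depends on it). A monomial is non-vanishing in $P(G)$ if its coefficient is nonzero. $G-\overrightarrow{v_kv_1v_2}$ denotes $G$ with the edges $v_kv_1$ and $v_1v_2$ deleted (vertices kept). *)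

theory Defs
  imports Main "HOL-Library.Poly_Mapping"
begin

text \<open>A simple graph is a vertex set together with a set of two-element edges.\<close>

type_synonym 'a graph = "'a set \<times> 'a set set"

abbreviation verts :: "'a graph \<Rightarrow> 'a set" where
  "verts G \<equiv> fst G"

abbreviation edges :: "'a graph \<Rightarrow> 'a set set" where
  "edges G \<equiv> snd G"

definition delete_edges :: "'a graph \<Rightarrow> 'a set set \<Rightarrow> 'a graph" where
  "delete_edges G F = (verts G, edges G - F)"

text \<open>
  \<open>wheel k vs c\<close> has rim \<open>vs 1, vs 2, \<dots>, vs k\<close> (in cyclic order) and hub \<open>c\<close>.
  It is the intended wheel only under the side conditions in \<open>is_wheel\<close>.
\<close>

definition wheel :: "nat \<Rightarrow> (nat \<Rightarrow> 'a) \<Rightarrow> 'a \<Rightarrow> 'a graph" where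
  "wheel k vs c =
    (insert c (vs ` {1..k}),
     {{vs i, vs (i + 1)} | i. i \<in> {1..<k}} \<union> {{vs k, vs 1}} \<union> {{c, vs i} | i. i \<in> {1..k}})"

definition is_wheel :: "'a graph \<Rightarrow> nat \<Rightarrow> (nat \<Rightarrow> 'a) \<Rightarrow> 'a \<Rightarrow> bool" where
  "is_wheel G k vs c \<longleftrightarrow>
    k \<ge> 3 \<and> inj_on vs {1..k} \<and> c \<notin> vs ` {1..k} \<and> G = wheel k vs c"

text \<open>
  Integer polynomials in the variables \<open>'a\<close>: a monomial is its finitely supported
  exponent function, a polynomial its finitely supported coefficient function, and the
  product on \<^typ>\<open>('a \<Rightarrow>\<^sub>0 nat) \<Rightarrow>\<^sub>0 int\<close> is convolution.
\<close>

type_synonym 'a monom = "'a \<Rightarrow>\<^sub>0 nat"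
type_synonym 'a int_mpoly = "'a monom \<Rightarrow>\<^sub>0 int"

definition Var :: "'a \<Rightarrow> 'a int_mpoly" where
  "Var u = Poly_Mapping.single (Poly_Mapping.single u 1) 1"

definition nonvanishing :: "'a monom \<Rightarrow> 'a int_mpoly \<Rightarrow> bool" where
  "nonvanishing m p \<longleftrightarrow> Poly_Mapping.lookup p m \<noteq> 0"

text \<open>
  \<open>orients R G\<close>: every edge of \<open>G\<close> is directed in exactly one way by \<open>R\<close>, where
  \<open>(u, v) \<in> R\<close> plays the role of \<open>u < v\<close>. Pairs in \<open>R\<close> that are not edges of \<open>G\<close> are
  irrelevant, so in particular every strict linear order on the vertices orients \<open>G\<close>.
\<close>

definition orients :: "('a \<times> 'a) set \<Rightarrow> 'a graph \<Rightarrow> bool" where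
  "orients R G \<longleftrightarrow> (\<forall>u v. {u, v} \<in> edges G \<longrightarrow> ((u, v) \<in> R \<longleftrightarrow> (v, u) \<notin> R))"

definition graph_poly :: "('a \<times> 'a) set \<Rightarrow> 'a graph \<Rightarrow> 'a int_mpoly" where
  "graph_poly R G = (\<Prod>(u, v) \<in> {(u, v). {u, v} \<in> edges G \<and> (u, v) \<in> R}. Var u - Var v)"

end

theory Submission
  imports Defs
begin

text \<open>
  The graph \<open>H\<close> has \<open>2 k - 2\<close> edges, so by homogeneity the bounds on the exponents force the
  monomial \<open>v\<^sup>4 v\<^sub>3\<^sup>2 \<cdots> v\<^sub>k\<^sub>-\<^sub>1\<^sup>2\<close>. Its coefficient is, up to sign, obtained by peeling the
  vertices \<open>v\<^sub>1, v\<^sub>2, v\<^sub>3, \<dots>\<close> off the fan one after the other. The spokes at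
  \<open>v\<^sub>1, v\<^sub>2, v\<^sub>k\<close> must contribute \<open>v\<close>, so exactly one of the other spokes does; its position
  determines the choice at every other edge, with signs alternating along the
  \<open>k - 3\<close> possible positions, so the coefficient is nonzero iff \<open>k - 3\<close> is odd.
\<close>

section \<open>Coefficients of products of differences of variables\<close>

lemma lookup_Var_mult_add:
  "Poly_Mapping.lookup (Var u * p) (Poly_Mapping.single u 1 + m) = Poly_Mapping.lookup p m"
  unfolding Var_def lookup_mult lookup_single when_mult
  by (simp only: mult_1 Sum_any_when_equal' add_left_cancel)

lemma lookup_Var_mult_eq_0:
  assumes "Poly_Mapping.lookup m u = 0"
  shows "Poly_Mapping.lookup (Var u * p) m = 0"
proof -
  have "m \<noteq> Poly_Mapping.single u 1 + q" for q
    using assms by (metis add_eq_0_iff_both_eq_0 lookup_add lookup_single_eq one_neq_zero)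
  then show ?thesis
    unfolding Var_def lookup_mult lookup_single when_mult
    by (simp only: mult_1 Sum_any_when_equal') simp
qed

text \<open>With \<open>V\<close> the whole vertex set this is total degree; with \<open>V\<close> a
  singleton it is the degree in one variable, which sorts the terms when a vertex is peeled off. The
  zero polynomial has every degree.\<close>

definition homogeneous_in :: "'a set \<Rightarrow> nat \<Rightarrow> 'a int_mpoly \<Rightarrow> bool" where
  "homogeneous_in V d p \<longleftrightarrow>
    (\<forall>m. Poly_Mapping.lookup p m \<noteq> 0 \<longrightarrow> (\<Sum>x\<in>V. Poly_Mapping.lookup m x) = d)"

lemma homogeneous_inD:
  "homogeneous_in V d p \<Longrightarrow> Poly_Mapping.lookup p m \<noteq> 0 \<Longrightarrow> (\<Sum>x\<in>V. Poly_Mapping.lookup m x) = d"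
  by (simp add: homogeneous_in_def)

lemma homogeneous_in_one: "homogeneous_in V 0 1"
  by (auto simp: homogeneous_in_def lookup_one when_def)

lemma homogeneous_in_mult:
  assumes "homogeneous_in V d p" and "homogeneous_in V e q"
  shows "homogeneous_in V (d + e) (p * q)"
  unfolding homogeneous_in_def
proof (intro allI impI)
  fix m assume "Poly_Mapping.lookup (p * q) m \<noteq> 0"
  then have "m \<in> Poly_Mapping.keys (p * q)"
    by (simp add: in_keys_iff)
  then obtain a b where "m = a + b" "a \<in> Poly_Mapping.keys p" "b \<in> Poly_Mapping.keys q"
    using keys_mult by blast
  then show "(\<Sum>x\<in>V. Poly_Mapping.lookup m x) = d + e"
    using assms by (simp add: homogeneous_in_def lookup_add sum.distrib in_keys_iff)
qed

lemma homogeneous_in_prod: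
  assumes "\<And>i. i \<in> I \<Longrightarrow> homogeneous_in V (d i) (f i)"
  shows "homogeneous_in V (\<Sum>i\<in>I. d i) (\<Prod>i\<in>I. f i)"
  using assms
  by (induction I rule: infinite_finite_induct)
     (auto intro: homogeneous_in_one homogeneous_in_mult)

lemma sum_lookup_single:
  assumes "finite V"
  shows "(\<Sum>x\<in>V. Poly_Mapping.lookup (Poly_Mapping.single u n) x) = (if u \<in> V then n else 0)"
  using assms by (simp add: lookup_single when_def)

lemma homogeneous_in_Var:
  assumes "finite V"
  shows "homogeneous_in V (if u \<in> V then 1 else 0) (Var u)"
  using assms by (auto simp: homogeneous_in_def Var_def lookup_single when_def sum_lookup_single)

lemma homogeneous_in_diff:
  assumes "homogeneous_in V d p" and "homogeneous_in V d q"
  shows "homogeneous_in V d (p - q)"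
  using assms unfolding homogeneous_in_def lookup_minus by (metis diff_0_right)

lemma homogeneous_in_Var_diff:
  assumes "finite V" and "u \<in> V \<longleftrightarrow> w \<in> V"
  shows "homogeneous_in V (if u \<in> V then 1 else 0) (Var u - Var w)"
  using homogeneous_in_Var[OF assms(1), of u] homogeneous_in_Var[OF assms(1), of w] assms(2)
  by (auto intro: homogeneous_in_diff split: if_splits)

section \<open>The fan\<close>

text \<open>Up to sign, the graph polynomial of the fan with hub \<open>c\<close> and path
  \<open>vs j\<close>, ..., \<open>vs k\<close>: spokes point away from the hub, path edges towards
  the larger index.\<close>

definition fan_poly :: "'a \<Rightarrow> (nat \<Rightarrow> 'a) \<Rightarrow> nat \<Rightarrow> nat \<Rightarrow> 'a int_mpoly" where
  "fan_poly c vs k j =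
    (\<Prod>i\<in>{j..k}. Var c - Var (vs i)) * (\<Prod>i\<in>{j..<k}. Var (vs i) - Var (vs (i + 1)))"

text \<open>The range stops before \<open>k\<close> because \<open>vs k\<close> has exponent 0 in
  the target monomial.\<close>

definition squares :: "(nat \<Rightarrow> 'a) \<Rightarrow> nat \<Rightarrow> nat \<Rightarrow> 'a monom" where
  "squares vs k j = (\<Sum>i\<in>{j..<k}. Poly_Mapping.single (vs i) 2)"

lemma single_Suc:
  "Poly_Mapping.single x (Suc n) = Poly_Mapping.single x 1 + Poly_Mapping.single x n"
  by (simp flip: single_add)

lemma fan_poly_rec:
  assumes "j < k"
  shows "fan_poly c vs k j =
    (Var c - Var (vs j)) * ((Var (vs j) - Var (vs (j + 1))) * fan_poly c vs k (j + 1))"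
  using assms
  by (simp add: fan_poly_def prod.atLeast_Suc_atMost prod.atLeast_Suc_lessThan algebra_simps)

text \<open>The square is split into two single factors so that \<open>lookup_Var_mult_add\<close>
  can cancel them one at a time.\<close>

lemma squares_rec:
  assumes "j < k"
  shows "squares vs k j =
    Poly_Mapping.single (vs j) 1 + (Poly_Mapping.single (vs j) 1 + squares vs k (j + 1))"
  using assms
  by (simp add: squares_def sum.atLeast_Suc_lessThan add.assoc numeral_2_eq_2
      single_Suc[of _ "Suc 0"])

lemma lookup_squares_outside:
  assumes "x \<notin> vs ` {j..<k}"
  shows "Poly_Mapping.lookup (squares vs k j) x = 0"
  using assms by (auto simp: squares_def lookup_sum lookup_single when_def)

section \<open>Coefficients of the fan polynomial over distinct vertices\<close>

context
  fixes vs :: "nat \<Rightarrow> 'a" and c :: 'a and k :: nat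
  assumes inj: "inj_on vs {1..k}" and hub: "c \<notin> vs ` {1..k}"
begin

lemma vs_eq_iff: "i \<in> {1..k} \<Longrightarrow> j \<in> {1..k} \<Longrightarrow> vs i = vs j \<longleftrightarrow> i = j"
  using inj by (simp add: inj_on_eq_iff)

lemma vs_neq_hub: "i \<in> {1..k} \<Longrightarrow> vs i \<noteq> c"
  using hub by auto

lemma lookup_squares_vs:
  assumes "1 \<le> i" "i < j" "i \<le> k"
  shows "Poly_Mapping.lookup (squares vs k j) (vs i) = 0"
  using assms vs_eq_iff by (intro lookup_squares_outside) force

lemma homogeneous_in_fan_poly:
  assumes "1 \<le> i" "i < j" "i \<le> k"
  shows "homogeneous_in {vs i} 0 (fan_poly c vs k j)"
proof -
  have ne: "vs i' \<noteq> vs i" if "i' \<in> {j..k}" for i'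
    using that assms vs_eq_iff[of i' i] by auto
  have "homogeneous_in {vs i} ((\<Sum>i'\<in>{j..k}. if c \<in> {vs i} then 1 else 0)
      + (\<Sum>i'\<in>{j..<k}. if vs i' \<in> {vs i} then 1 else 0)) (fan_poly c vs k j)"
    unfolding fan_poly_def using assms ne vs_neq_hub[of i]
    by (intro homogeneous_in_mult homogeneous_in_prod homogeneous_in_Var_diff) auto
  moreover have "(\<Sum>i'\<in>{j..k}. if c \<in> {vs i} then 1 else 0)
      + (\<Sum>i'\<in>{j..<k}. if vs i' \<in> {vs i} then 1 else 0) = (0 :: nat)"
    using assms ne vs_neq_hub[of i] by auto
  ultimately show ?thesis by (simp only:)
qed

text \<open>Sorts the terms of \<open>fan_poly_rec\<close> by their degree in \<open>v\<^sub>j\<close>.\<close>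

lemma lookup_fan_poly:
  assumes "1 \<le> j" "j < k"
  defines "F \<equiv> fan_poly c vs k (j + 1)"
  shows "Poly_Mapping.lookup (fan_poly c vs k j) m =
    (let d = Poly_Mapping.lookup m (vs j) in
      if d = 0 then - Poly_Mapping.lookup (Var c * (Var (vs (j + 1)) * F)) m
      else if d = 1 then Poly_Mapping.lookup (Var (vs j) * (Var c * F)) m
        + Poly_Mapping.lookup (Var (vs j) * (Var (vs (j + 1)) * F)) m
      else if d = 2 then - Poly_Mapping.lookup (Var (vs j) * (Var (vs j) * F)) m
      else 0)"
proof -
  have ne: "c \<noteq> vs j" "vs (j + 1) \<noteq> vs j"
    using assms vs_eq_iff[of "j + 1" j] vs_neq_hub[of j] by auto
  have F: "homogeneous_in {vs j} 0 F"
    unfolding F_def using assms by (intro homogeneous_in_fan_poly) auto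
  have Var0: "homogeneous_in {vs j} 0 (Var u)" if "u \<noteq> vs j" for u
    using that homogeneous_in_Var[of "{vs j}" u] by simp
  have Var1: "homogeneous_in {vs j} 1 (Var (vs j))"
    using homogeneous_in_Var[of "{vs j}" "vs j"] by simp
  have vanish: "Poly_Mapping.lookup p m = 0"
    if "homogeneous_in {vs j} d p" "Poly_Mapping.lookup m (vs j) \<noteq> d" for p d
    using homogeneous_inD[OF that(1), of m] that(2) by auto
  \<comment> \<open>The four terms obtained by choosing an endpoint of the spoke and of the path
    edge at \<open>vs j\<close> have degrees 0, 1, 1, 2 in \<open>vs j\<close>, so each exponent
    selects its own terms.\<close>
  have 0: "homogeneous_in {vs j} (0 + (0 + 0)) (Var c * (Var (vs (j + 1)) * F))"
    and 1: "homogeneous_in {vs j} (1 + (0 + 0)) (Var (vs j) * (Var c * F))"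
    and 2: "homogeneous_in {vs j} (1 + (0 + 0)) (Var (vs j) * (Var (vs (j + 1)) * F))"
    and 3: "homogeneous_in {vs j} (1 + (1 + 0)) (Var (vs j) * (Var (vs j) * F))"
    using F Var0 Var1 ne by (blast intro: homogeneous_in_mult)+
  have "fan_poly c vs k j = Var (vs j) * (Var c * F) + Var (vs j) * (Var (vs (j + 1)) * F)
      - Var c * (Var (vs (j + 1)) * F) - Var (vs j) * (Var (vs j) * F)"
    using assms by (simp add: fan_poly_rec algebra_simps)
  then show ?thesis
    using vanish[OF 0] vanish[OF 1] vanish[OF 2] vanish[OF 3]
    by (simp add: lookup_add lookup_minus Let_def)
qed

text \<open>Exponent 2 at a path vertex forces its spoke to give minus that vertex and its outgoing
  path edge to give plus it, a factor -1 per vertex. The last spoke, at \<open>vs k\<close>, then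
  gives the hub.\<close>

lemma lookup_fan_poly_one_spoke:
  assumes "1 \<le> j" "j \<le> k"
  shows "Poly_Mapping.lookup (fan_poly c vs k j) (Poly_Mapping.single c 1 + squares vs k j)
    = (- 1) ^ (k - j)"
  using assms(2,1)
proof (induction j rule: inc_induct)
  case base
  have "Poly_Mapping.single (vs k) (1 :: nat) \<noteq> Poly_Mapping.single c 1"
    using vs_neq_hub[of k] base by (metis atLeastAtMost_iff lookup_single_eq
      lookup_single_not_eq order_refl zero_neq_one)
  then show ?case
    by (simp add: fan_poly_def squares_def Var_def lookup_minus lookup_single when_def)
next
  case (step j)
  let ?m = "Poly_Mapping.single c 1 + squares vs k j"
  have m: "?m = Poly_Mapping.single (vs j) 1 + (Poly_Mapping.single (vs j) 1
      + (Poly_Mapping.single c 1 + squares vs k (j + 1)))"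
    using step by (simp add: squares_rec ac_simps)
  have "Poly_Mapping.lookup ?m (vs j) = 2"
    unfolding m using step vs_neq_hub[of j]
    by (simp add: lookup_add lookup_squares_vs lookup_single_not_eq)
  then have "Poly_Mapping.lookup (fan_poly c vs k j) ?m
      = - Poly_Mapping.lookup (Var (vs j) * (Var (vs j) * fan_poly c vs k (j + 1))) ?m"
    using step by (simp add: lookup_fan_poly)
  also have "\<dots> = - ((- 1) ^ (k - (j + 1)))"
    unfolding m lookup_Var_mult_add using step by simp
  also have "\<dots> = (- 1) ^ (k - j)"
    using step by (simp flip: Suc_diff_Suc)
  finally show ?case .
qed

text \<open>If the spoke at \<open>vs j\<close> gives the hub, the path edge gives
  \<open>vs j\<close> and the one-spoke case remains. Otherwise both edges contribute a minus sign,
  and cancelling one \<open>vs (j + 1)\<close> leaves the same problem at \<open>j + 1\<close>. The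
  resulting alternating sum has \<open>k - j\<close> terms and ends in +1.\<close>

lemma lookup_fan_poly_two_spokes:
  assumes "1 \<le> j" "j < k"
  shows "Poly_Mapping.lookup (fan_poly c vs k j)
      (Poly_Mapping.single c 2 + (Poly_Mapping.single (vs j) 1 + squares vs k (j + 1)))
    = of_bool (odd (k - j))"
  using less_imp_le_nat[OF assms(2)] assms
proof (induction j rule: inc_induct)
  case (step j)
  let ?F = "fan_poly c vs k (j + 1)" and ?T = "squares vs k (j + 1)"
  let ?m = "Poly_Mapping.single c 2 + (Poly_Mapping.single (vs j) 1 + ?T)"
  \<comment> \<open>Two groupings of the same monomial, one for each of the two surviving
    terms.\<close>
  have m: "?m = Poly_Mapping.single (vs j) 1 + (Poly_Mapping.single c 1
      + (Poly_Mapping.single c 1 + ?T))"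
      "?m = Poly_Mapping.single (vs j) 1 + (Poly_Mapping.single c 2 + ?T)"
    by (simp_all add: ac_simps numeral_2_eq_2 single_Suc[of _ "Suc 0"])
  have "Poly_Mapping.lookup ?m (vs j) = 1"
    using step vs_neq_hub[of j]
    by (simp add: lookup_add lookup_squares_vs lookup_single_not_eq)
  then have "Poly_Mapping.lookup (fan_poly c vs k j) ?m
      = Poly_Mapping.lookup (Var (vs j) * (Var c * ?F)) ?m
      + Poly_Mapping.lookup (Var (vs j) * (Var (vs (j + 1)) * ?F)) ?m"
    using step by (simp add: lookup_fan_poly)
  also have "Poly_Mapping.lookup (Var (vs j) * (Var c * ?F)) ?m = (- 1) ^ (k - (j + 1))"
    unfolding m(1) lookup_Var_mult_add using step by (intro lookup_fan_poly_one_spoke) auto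
  also have "Poly_Mapping.lookup (Var (vs j) * (Var (vs (j + 1)) * ?F)) ?m
      = Poly_Mapping.lookup (Var (vs (j + 1)) * ?F) (Poly_Mapping.single c 2 + ?T)"
    unfolding m(2) lookup_Var_mult_add ..
  \<comment> \<open>At \<open>j + 1 = k\<close> the path edge would give \<open>vs k\<close>, whose
    exponent is 0, so this term vanishes and the recursion stops.\<close>
  also have "\<dots> = of_bool (j + 1 < k \<and> odd (k - (j + 1)))"
  proof (cases "j + 1 < k")
    case True
    have T: "Poly_Mapping.single c 2 + ?T = Poly_Mapping.single (vs (j + 1)) 1
        + (Poly_Mapping.single c 2 + (Poly_Mapping.single (vs (j + 1)) 1
        + squares vs k (j + 1 + 1)))"
      using squares_rec[OF True, of vs] by (simp add: ac_simps)
    show ?thesis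
      unfolding T lookup_Var_mult_add using True step.IH by simp
  next
    case False
    then have "j + 1 = k" using step by simp
    then have "Poly_Mapping.lookup (Poly_Mapping.single c 2 + ?T) (vs (j + 1)) = 0"
      using step vs_neq_hub[of k]
      by (simp add: squares_def lookup_add lookup_single_not_eq)
    then show ?thesis
      using False by (simp add: lookup_Var_mult_eq_0)
  qed
  also have "(- 1) ^ (k - (j + 1)) + of_bool (j + 1 < k \<and> odd (k - (j + 1)))
      = (of_bool (odd (k - j)) :: int)"
    using step by (cases "j + 1 = k") (auto simp: minus_one_power_iff)
  finally show ?case .
qed simp

text \<open>Exponent 0 at \<open>vs 1\<close> and \<open>vs 2\<close> makes both spokes there give
  the hub and the edge from \<open>vs 2\<close> give \<open>- vs 3\<close>. What is left is the
  two-spoke coefficient at \<open>j = 3\<close>, and \<open>k - 3\<close> is odd iff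
  \<open>k\<close> is even.\<close>

lemma lookup_pruned_wheel:
  assumes "3 \<le> k"
  shows "Poly_Mapping.lookup ((Var c - Var (vs 1)) * fan_poly c vs k 2)
      (Poly_Mapping.single c 4 + squares vs k 3) = - of_bool (even k)"
proof -
  let ?m = "\<lambda>a. Poly_Mapping.single c a + squares vs k 3"
  have m: "?m 4 = Poly_Mapping.single c 1 + ?m 3" "?m 3 = Poly_Mapping.single c 1 + ?m 2"
    using single_Suc[of c 3] single_Suc[of c 2] by (simp_all add: add.assoc)
  have 0: "Poly_Mapping.lookup (?m a) (vs i) = 0" if "i \<in> {1, 2}" for a i
    using that assms vs_neq_hub[of i]
    by (auto simp: lookup_add lookup_squares_vs lookup_single_not_eq)
  have "Poly_Mapping.lookup ((Var c - Var (vs 1)) * fan_poly c vs k 2) (?m 4)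
      = Poly_Mapping.lookup (fan_poly c vs k 2) (?m 3)"
    using lookup_Var_mult_eq_0[OF 0[of 1 4], of "fan_poly c vs k 2"]
    unfolding m(1) by (simp only: left_diff_distrib lookup_minus lookup_Var_mult_add) simp
  also have "\<dots> = - Poly_Mapping.lookup (Var c * (Var (vs 3) * fan_poly c vs k 3)) (?m 3)"
    using assms 0[of 2 3] by (simp add: lookup_fan_poly)
  also have "\<dots> = - Poly_Mapping.lookup (Var (vs 3) * fan_poly c vs k 3) (?m 2)"
    unfolding m(2) lookup_Var_mult_add ..
  also have "\<dots> = - of_bool (even k)"
  \<comment> \<open>For \<open>k = 3\<close> the forced factor \<open>vs 3\<close> is
    \<open>vs k\<close>, which must have exponent 0; the coefficient is 0, as \<open>k\<close> is
    odd.\<close>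
  proof (cases "k = 3")
    case True
    then have "Poly_Mapping.lookup (?m 2) (vs 3) = 0"
      using vs_neq_hub[of 3] by (simp add: squares_def lookup_add lookup_single_not_eq)
    then show ?thesis
      using True by (simp add: lookup_Var_mult_eq_0)
  next
    case False
    then have "3 < k" using assms by simp
    have T: "?m 2 = Poly_Mapping.single (vs 3) 1 + (Poly_Mapping.single c 2
        + (Poly_Mapping.single (vs 3) 1 + squares vs k (3 + 1)))"
      using squares_rec[OF \<open>3 < k\<close>, of vs] by (simp add: ac_simps)
    show ?thesis
      unfolding T lookup_Var_mult_add
      using \<open>3 < k\<close> lookup_fan_poly_two_spokes[of 3] by simp
  qed
  finally show ?thesis .
qed

end

section \<open>Graph polynomials\<close>

text \<open>
  The set \<open>A\<close> lists every edge once, in a direction that need not agree with \<open>R\<close>.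
\<close>

lemma graph_poly_up_to_sign:
  fixes A :: "('a \<times> 'a) set"
  assumes "orients R G" and "inj_on (\<lambda>(x, y). {x, y}) A"
    and "edges G = (\<lambda>(x, y). {x, y}) ` A"
  shows "\<exists>s \<in> {1, - 1}. graph_poly R G = s * (\<Prod>(x, y)\<in>A. Var x - Var y)"
proof -
  let ?f = "\<lambda>(x :: 'a, y). Var x - Var y"
  \<comment> \<open>Reverses exactly the pairs that disagree with \<open>R\<close>; each reversal
    negates one factor.\<close>
  define flip where "flip = (\<lambda>(x, y). if (x, y) \<in> R then (x, y) else (y, x))"
  have edge: "{x, y} \<in> edges G" if "(x, y) \<in> A" for x y
    using that assms(3) by force
  have bij: "bij_betw flip A {(u, v). {u, v} \<in> edges G \<and> (u, v) \<in> R}"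
    unfolding bij_betw_def
  proof
    \<comment> \<open>Reversal preserves the underlying edge, so injectivity of the edge map on
      \<open>A\<close> passes to \<open>flip\<close>.\<close>
    have "(\<lambda>(x, y). {x, y}) \<circ> flip = (\<lambda>(x, y). {x, y})"
      by (auto simp: flip_def fun_eq_iff)
    with assms(2) show "inj_on flip A"
      by (metis inj_on_imageI2)
    show "flip ` A = {(u, v). {u, v} \<in> edges G \<and> (u, v) \<in> R}"
    proof (intro equalityI subsetI)
      fix p assume "p \<in> flip ` A"
      then obtain x y where xy: "(x, y) \<in> A" "p = flip (x, y)" by auto
      have "(x, y) \<in> R \<longleftrightarrow> (y, x) \<notin> R"
        using edge[OF xy(1)] assms(1) unfolding orients_def by blast
      with xy(2) edge[OF xy(1)] show "p \<in> {(u, v). {u, v} \<in> edges G \<and> (u, v) \<in> R}"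
        by (cases "(x, y) \<in> R") (simp_all add: flip_def insert_commute[of y x])
    next
      fix p assume "p \<in> {(u, v). {u, v} \<in> edges G \<and> (u, v) \<in> R}"
      then obtain u v x y where uv: "p = (u, v)" "{u, v} \<in> edges G" "(u, v) \<in> R"
        and xy: "(x, y) \<in> A" "{u, v} = {x, y}"
        using assms(3) by force
      moreover have "(v, u) \<notin> R"
        using uv assms(1) by (auto simp: orients_def)
      ultimately have "p = flip (x, y)"
        by (auto simp: flip_def doubleton_eq_iff)
      then show "p \<in> flip ` A" using xy by blast
    qed
  qed
  have "graph_poly R G = (\<Prod>e\<in>A. ?f (flip e))"
    unfolding graph_poly_def by (rule prod.reindex_bij_betw[OF bij, symmetric])
  also have "\<dots> = (\<Prod>e\<in>A. (if e \<in> R then 1 else - 1) * ?f e)"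
    by (intro prod.cong) (auto simp: flip_def)
  also have "\<dots> = (\<Prod>e\<in>A. if e \<in> R then 1 else - 1) * (\<Prod>e\<in>A. ?f e)"
    by (rule prod.distrib)
  finally have eq: "graph_poly R G = \<dots>" .
  have "(\<Prod>e\<in>A. if e \<in> R then 1 else - 1) \<in> {1, - 1 :: 'a int_mpoly}"
    \<comment> \<open>A product over an infinite set is 1 by convention, which settles the infinite
      case.\<close>
    by (induction A rule: infinite_finite_induct) auto
  with eq show ?thesis by blast
qed

text \<open>After the deletion only the spoke remains at \<open>vs 1\<close>; all other edges form
  the fan over \<open>vs 2\<close>, ..., \<open>vs k\<close>.\<close>

lemma graph_poly_pruned_wheel:
  assumes "is_wheel G k vs c"
    and "orients R (delete_edges G {{vs k, vs 1}, {vs 1, vs 2}})"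
  shows "\<exists>s \<in> {1, - 1}. graph_poly R (delete_edges G {{vs k, vs 1}, {vs 1, vs 2}})
    = s * ((Var c - Var (vs 1)) * fan_poly c vs k 2)"
proof -
  let ?H = "delete_edges G {{vs k, vs 1}, {vs 1, vs 2}}"
  have k: "3 \<le> k" and inj: "inj_on vs {1..k}" and hub: "c \<notin> vs ` {1..k}"
    and G: "G = wheel k vs c"
    using assms(1) by (auto simp: is_wheel_def)
  have vs_eq: "vs i = vs j \<longleftrightarrow> i = j" if "i \<in> {1..k}" "j \<in> {1..k}" for i j
    using vs_eq_iff[OF inj hub that] .
  have vs_hub: "vs i \<noteq> c" if "i \<in> {1..k}" for i
    using vs_neq_hub[OF inj hub that] .
  let ?S = "(\<lambda>i. (c, vs i)) ` {1..k}" and ?P = "(\<lambda>i. (vs i, vs (i + 1))) ` {2..<k}"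
  have inj_A: "inj_on (\<lambda>(x, y). {x, y}) (?S \<union> ?P)"
  proof -
    have "c \<noteq> vs i" "vs i \<noteq> c" if "i \<in> {1..k}" for i
      using vs_hub[OF that] by simp_all
    moreover have "c \<noteq> vs (Suc i)" "vs (Suc i) \<noteq> c" if "i \<in> {2..<k}" for i
      using vs_hub[of "Suc i"] that by simp_all
    ultimately show ?thesis
      using vs_eq by (fastforce simp: inj_on_def doubleton_eq_iff)
  qed
  have "edges ?H = (\<lambda>(x, y). {x, y}) ` (?S \<union> ?P)"
  proof -
    have *: "{1..<k} = insert 1 {2..<k}" using k by auto
    let ?D = "{{vs k, vs 1}, {vs 1, vs 2}}"
    let ?E = "(\<lambda>i. {vs i, vs (i + 1)}) ` {2..<k} \<union> (\<lambda>i. {c, vs i}) ` {1..k}"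
    \<comment> \<open>Both deleted edges contain \<open>vs 1\<close> and avoid the hub, whereas the
      remaining rim edges avoid \<open>vs 1\<close> and the spokes contain the hub.\<close>
    have "{vs i, vs (i + 1)} \<notin> ?D" if "i \<in> {2..<k}" for i
      using that k vs_eq by (auto simp: doubleton_eq_iff)
    moreover have "{c, vs i} \<notin> ?D" if "i \<in> {1..k}" for i
      using that k vs_hub[of k] vs_hub[of 1] vs_hub[of 2] by (auto simp: doubleton_eq_iff)
    ultimately have disj: "?D \<inter> ?E = {}" by blast
    have edges: "edges G = ?D \<union> ?E"
      unfolding G wheel_def * by (auto simp: numeral_2_eq_2)
    have Un_Diff_disjoint: "(D \<union> E) - D = E" if "D \<inter> E = {}" for D E :: "'a set set"
      using that by blast
    have "edges ?H = ?E"
      unfolding delete_edges_def snd_conv edges by (rule Un_Diff_disjoint[OF disj])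
    then show ?thesis
      by (simp add: image_Un image_image Un_commute)
  qed
  from graph_poly_up_to_sign[OF assms(2) inj_A this] obtain s where s: "s \<in> {1, - 1}"
    "graph_poly R ?H = s * (\<Prod>(x, y)\<in>?S \<union> ?P. Var x - Var y)" by blast
  have disj: "?S \<inter> ?P = {}"
  proof (rule equals0I)
    fix e assume "e \<in> ?S \<inter> ?P"
    then obtain i where "c = vs i" "i \<in> {2..<k}" by auto
    then show False using vs_hub[of i] by simp
  qed
  have "(\<Prod>(x, y)\<in>?S \<union> ?P. Var x - Var y)
      = (\<Prod>(x, y)\<in>?S. Var x - Var y) * (\<Prod>(x, y)\<in>?P. Var x - Var y)"
    by (intro prod.union_disjoint disj) simp_all
  also have "(\<Prod>(x, y)\<in>?S. Var x - Var y) = (\<Prod>i\<in>{1..k}. Var c - Var (vs i))"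
  proof -
    have "inj_on (\<lambda>i. (c, vs i)) {1..k}"
      using vs_eq by (intro inj_onI) simp
    then show ?thesis by (simp add: prod.reindex)
  qed
  also have "(\<Prod>(x, y)\<in>?P. Var x - Var y) = (\<Prod>i\<in>{2..<k}. Var (vs i) - Var (vs (i + 1)))"
  proof -
    have "inj_on (\<lambda>i. (vs i, vs (i + 1))) {2..<k}"
      using vs_eq by (intro inj_onI) simp
    then show ?thesis by (simp add: prod.reindex)
  qed
  also have "(\<Prod>i\<in>{1..k}. Var c - Var (vs i))
      = (Var c - Var (vs 1)) * (\<Prod>i\<in>{2..k}. Var c - Var (vs i))"
    using k by (simp add: prod.atLeast_Suc_atMost numeral_2_eq_2)
  finally show ?thesis
    using s by (auto simp: fan_poly_def mult.assoc)
qed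

text \<open>Each edge contributes degree 1, and there are 1 + (k - 1) + (k - 2) edges.\<close>

lemma degree_pruned_wheel:
  assumes "is_wheel G k vs c"
  shows "homogeneous_in (verts G) (2 * k - 2) ((Var c - Var (vs 1)) * fan_poly c vs k 2)"
proof -
  let ?V = "verts G"
  have k: "3 \<le> k" using assms by (simp add: is_wheel_def)
  have V: "finite ?V" "c \<in> ?V" "\<And>i. i \<in> {1..k} \<Longrightarrow> vs i \<in> ?V"
    using assms by (auto simp: is_wheel_def wheel_def)
  have diff: "homogeneous_in ?V 1 (Var x - Var y)" if "x \<in> ?V" "y \<in> ?V" for x y
    using homogeneous_in_Var_diff[of ?V x y] that V by simp
  have "homogeneous_in ?V (1 + ((\<Sum>i\<in>{2..k}. 1) + (\<Sum>i\<in>{2..<k}. 1)))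
      ((Var c - Var (vs 1)) * fan_poly c vs k 2)"
    unfolding fan_poly_def using k
    by (intro homogeneous_in_mult homogeneous_in_prod diff V) auto
  then show ?thesis
    using k by (auto simp: mult_2 elim!: back_subst[of "\<lambda>d. homogeneous_in ?V d _"])
qed

section \<open>Forced exponents and the parity criterion\<close>

theorem theorem5p2:
  fixes G :: "'a graph" and H :: "'a graph" and k :: nat
    and vs :: "nat \<Rightarrow> 'a" and v :: 'a and R :: "('a \<times> 'a) set"
  assumes "is_wheel G k vs v"
    and "H = delete_edges G {{vs k, vs 1}, {vs 1, vs 2}}"
    and "orients R H"
  shows "(\<exists>(a :: nat) (b :: nat \<Rightarrow> nat).
            nonvanishing
              (Poly_Mapping.single (vs 1) 0 + Poly_Mapping.single (vs 2) 0
                + Poly_Mapping.single (vs k) 0 + Poly_Mapping.single v a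
                + (\<Sum>i\<in>{3..k - 1}. Poly_Mapping.single (vs i) (b i)))
              (graph_poly R H)
            \<and> (\<forall>i\<in>{3..k - 1}. b i \<le> 2) \<and> a \<le> 4)
         \<longleftrightarrow> even k"
proof -
  let ?P = "(Var v - Var (vs 1)) * fan_poly v vs k 2"
  let ?m = "\<lambda>a b. Poly_Mapping.single (vs 1) 0 + Poly_Mapping.single (vs 2) 0
    + Poly_Mapping.single (vs k) 0 + Poly_Mapping.single v a
    + (\<Sum>i\<in>{3..k - 1}. Poly_Mapping.single (vs i) (b i)) :: 'a monom"
  have k: "3 \<le> k" and inj: "inj_on vs {1..k}" and hub: "v \<notin> vs ` {1..k}"
    and V: "finite (verts G)" "v \<in> verts G" "\<And>i. i \<in> {1..k} \<Longrightarrow> vs i \<in> verts G"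
    using assms(1) by (auto simp: is_wheel_def wheel_def)
  have interval: "{3..k - 1} = {3..<k}" using k by auto
  have sign: "nonvanishing m (graph_poly R H) \<longleftrightarrow> Poly_Mapping.lookup ?P m \<noteq> 0" for m
    using graph_poly_pruned_wheel[OF assms(1), of R] assms(2,3)
    by (auto simp: nonvanishing_def)
  have m_eq: "?m 4 b = Poly_Mapping.single v 4 + squares vs k 3"
    if "\<forall>i\<in>{3..k - 1}. b i = 2" for b
    using that unfolding squares_def interval by simp
  have main: "nonvanishing (?m 4 b) (graph_poly R H) \<longleftrightarrow> even k"
    if "\<forall>i\<in>{3..k - 1}. b i = 2" for b
    unfolding sign m_eq[OF that] lookup_pruned_wheel[OF inj hub k] by simp
  \<comment> \<open>The bounds allow total degree at most 4 + 2 (k - 3) = 2 k - 2, which is the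
    actual degree, so every bound is attained.\<close>
  have forced: "a = 4 \<and> (\<forall>i\<in>{3..k - 1}. b i = 2)"
    if nonvan: "nonvanishing (?m a b) (graph_poly R H)"
      and b: "\<forall>i\<in>{3..k - 1}. b i \<le> 2" and a: "a \<le> 4" for a b
  proof -
    have "(\<Sum>x\<in>verts G. Poly_Mapping.lookup (?m a b) x) = 2 * k - 2"
      using homogeneous_inD[OF degree_pruned_wheel[OF assms(1)]] nonvan unfolding sign by blast
    moreover have "(\<Sum>x\<in>verts G. Poly_Mapping.lookup (?m a b) x)
        = a + (\<Sum>x\<in>verts G. \<Sum>i\<in>{3..k - 1}. Poly_Mapping.lookup (Poly_Mapping.single (vs i) (b i)) x)"
      using V by (simp add: lookup_add lookup_sum sum.distrib sum_lookup_single)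
    moreover have "(\<Sum>x\<in>verts G. \<Sum>i\<in>{3..k - 1}. Poly_Mapping.lookup (Poly_Mapping.single (vs i) (b i)) x)
        = (\<Sum>i\<in>{3..k - 1}. b i)"
      using V by (subst sum.swap) (auto simp: sum_lookup_single intro!: sum.cong)
    ultimately have deg: "a + (\<Sum>i\<in>{3..k - 1}. b i) = 2 * k - 2" by simp
    \<comment> \<open>The defects \<open>2 - b i\<close> are natural numbers, so their sum being 0
      makes each of them 0.\<close>
    have "(\<Sum>i\<in>{3..k - 1}. 2 - b i) = (\<Sum>i\<in>{3..k - 1}. 2) - (\<Sum>i\<in>{3..k - 1}. b i)"
      using b by (intro sum_subtractf_nat) auto
    also have "\<dots> = 0" using deg a k by simp
    finally have "\<forall>i\<in>{3..k - 1}. b i = 2"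
      using b by (auto intro: antisym)
    moreover from this have "(\<Sum>i\<in>{3..k - 1}. b i) = 2 * (k - 3)" using k by simp
    ultimately show ?thesis using deg k by simp
  qed
  show ?thesis (is "?L \<longleftrightarrow> _")
  proof
    assume ?L
    then obtain a b where ab: "nonvanishing (?m a b) (graph_poly R H)"
      "\<forall>i\<in>{3..k - 1}. b i \<le> 2" "a \<le> 4"
      by (elim exE conjE)
    from forced[OF ab] ab(1) main[of b] show "even k"
      by (elim conjE) (simp only:)
  next
    assume "even k"
    then show ?L
      using main[of "\<lambda>_. 2"] by (intro exI[of _ 4] exI[of _ "\<lambda>_. 2"]) simp
  qed
qed

end
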